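(* Let $r>s\ge 0$ be integers, let $k=2r-s$, and let $n\ge 1$ be an integer. Let $c_{k,n,o}^{r,s}$ (respectively $c_{k,n,e}^{r,s}$) be the number of odd (respectively even) compositions of $n+k-1$ all of whose parts are no less than $k$ and congruent to $k+s$ modulo $r$, and let $b_{k,n}^{r,s}:=c_{k,n,o}^{r,s}-c_{k,n,e}^{r,s}$. Then $b_{k,n}^{r,s}=(-1)^j$ if $n\in\{3rj+s+1,\ 3rj+r+s+1\}$ for some integer $j\ge 0$, and $b_{k,n}^{r,s}=0$ otherwise.
   Context: A composition of a nonnegative integer $N$ is a finite sequence $\alpha=(\alpha_1,\ldots,\alpha_\ell)$ of positive integers with $\alpha_1+\cdots+\alpha_\ell=N$; the $\alpha_i$ are its parts and $\ell$ is its length. A composition is called even (respectively odd) if its length $\ell$ is even (respectively odd). *)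

theory Defs
  imports "HOL-Number_Theory.Cong"
begin

definition composition :: "nat \<Rightarrow> nat list \<Rightarrow> bool" where
  "composition N \<alpha> \<longleftrightarrow> (\<forall>a\<in>set \<alpha>. 0 < a) \<and> sum_list \<alpha> = N"

(* n + k - 1 is natural-number subtraction; it does not truncate when n \<ge> 1. *)
definition compositions :: "nat \<Rightarrow> nat \<Rightarrow> nat \<Rightarrow> nat \<Rightarrow> nat list set" where
  "compositions r s k n =
     {\<alpha>. composition (n + k - 1) \<alpha> \<and> (\<forall>a\<in>set \<alpha>. k \<le> a \<and> [a = k + s] (mod r))}"

definition c_odd :: "nat \<Rightarrow> nat \<Rightarrow> nat \<Rightarrow> nat \<Rightarrow> nat" where
  "c_odd r s k n = card {\<alpha> \<in> compositions r s k n. odd (length \<alpha>)}"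

definition c_even :: "nat \<Rightarrow> nat \<Rightarrow> nat \<Rightarrow> nat \<Rightarrow> nat" where
  "c_even r s k n = card {\<alpha> \<in> compositions r s k n. even (length \<alpha>)}"

definition b :: "nat \<Rightarrow> nat \<Rightarrow> nat \<Rightarrow> nat \<Rightarrow> int" where
  "b r s k n = int (c_odd r s k n) - int (c_even r s k n)"

end

(* Since k + s = 2r and r < k, the admissible parts are exactly the multiples of r that are at
   least 2r. So only totals n + k - 1 = r M contribute, and dividing by r leaves the compositions
   of M into parts at least 2. Splitting these according to whether the first part is 2 or larger
   (and decreasing it in the latter case) shows that the count g M signed by (-1)^length satisfies
   g M = g (M - 1) - g (M - 2); equivalently, its generating function is
   (1 - x) / (1 - x + x^2) = (1 - x^2) / (1 + x^3). *)
theory Submission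
  imports Defs
begin

definition comps_ge2 :: "nat \<Rightarrow> nat list set" where
  "comps_ge2 M = {xs. (\<forall>a\<in>set xs. 2 \<le> a) \<and> sum_list xs = M}"

definition signed_count :: "nat \<Rightarrow> int" where
  "signed_count M = (\<Sum>xs\<in>comps_ge2 M. (-1) ^ length xs)"

text \<open>The value at \<open>[]\<close> is a dummy that keeps the map injective and
  length-preserving on all lists; the compositions it is applied to are nonempty.\<close>

fun inc_hd :: "nat list \<Rightarrow> nat list" where
  "inc_hd [] = []"
| "inc_hd (x # xs) = Suc x # xs"

lemma length_inc_hd [simp]: "length (inc_hd xs) = length xs"
  by (cases xs) auto

lemma inj_inc_hd: "inj inc_hd"
proof (rule injI)
  fix xs ys assume "inc_hd xs = inc_hd ys"
  then show "xs = ys" by (cases xs; cases ys) auto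
qed

lemma comps_ge2_0: "comps_ge2 0 = {[]}"
proof -
  have "xs = []" if "xs \<in> comps_ge2 0" for xs
    using that by (cases xs) (auto simp: comps_ge2_def)
  then show ?thesis by (auto simp: comps_ge2_def)
qed

lemma comps_ge2_1: "comps_ge2 (Suc 0) = {}"
proof -
  have False if "xs \<in> comps_ge2 (Suc 0)" for xs
    using that by (cases xs) (auto simp: comps_ge2_def)
  then show ?thesis by blast
qed

lemma comps_ge2_Suc_Suc:
  "comps_ge2 (Suc (Suc M)) = (#) 2 ` comps_ge2 M \<union> inc_hd ` comps_ge2 (Suc M)"
proof (intro equalityI subsetI)
  fix xs assume xs: "xs \<in> comps_ge2 (Suc (Suc M))"
  then obtain y ys where y: "xs = y # ys" by (cases xs) (auto simp: comps_ge2_def)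
  show "xs \<in> (#) 2 ` comps_ge2 M \<union> inc_hd ` comps_ge2 (Suc M)"
  proof (cases "y = 2")
    case True
    then show ?thesis using xs y by (auto simp: comps_ge2_def)
  next
    case False
    \<comment> \<open>Here \<open>y\<close> is at least 3, so lowering it leaves a part that is
      still at least 2.\<close>
    then have "xs = inc_hd ((y - 1) # ys)" "(y - 1) # ys \<in> comps_ge2 (Suc M)"
      using xs y by (auto simp: comps_ge2_def)
    then show ?thesis by blast
  qed
next
  fix xs assume "xs \<in> (#) 2 ` comps_ge2 M \<union> inc_hd ` comps_ge2 (Suc M)"
  then show "xs \<in> comps_ge2 (Suc (Suc M))"
  proof
    assume "xs \<in> inc_hd ` comps_ge2 (Suc M)"
    then obtain zs where zs: "xs = inc_hd zs" "zs \<in> comps_ge2 (Suc M)" by blast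
    then show ?thesis by (cases zs) (auto simp: comps_ge2_def)
  qed (auto simp: comps_ge2_def)
qed

lemma finite_comps_ge2: "finite (comps_ge2 M)"
  by (induction M rule: induct_nat_012) (simp_all add: comps_ge2_0 comps_ge2_1 comps_ge2_Suc_Suc)

lemma signed_count_Suc_Suc:
  "signed_count (Suc (Suc M)) = signed_count (Suc M) - signed_count M"
proof -
  \<comment> \<open>Lists in \<open>comps_ge2 (Suc M)\<close> are nonempty, so after
    \<open>inc_hd\<close> the first part is at least 3.\<close>
  have disj: "(#) 2 ` comps_ge2 M \<inter> inc_hd ` comps_ge2 (Suc M) = {}"
  proof -
    have "inc_hd zs \<noteq> 2 # ys" if "zs \<in> comps_ge2 (Suc M)" for zs ys
      using that by (cases zs) (auto simp: comps_ge2_def)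
    then show ?thesis by (metis (no_types, lifting) disjoint_iff imageE)
  qed
  have "signed_count (Suc (Suc M)) = (\<Sum>xs\<in>(#) 2 ` comps_ge2 M. (-1) ^ length xs)
      + (\<Sum>xs\<in>inc_hd ` comps_ge2 (Suc M). (-1) ^ length xs)"
    unfolding signed_count_def comps_ge2_Suc_Suc
    by (intro sum.union_disjoint disj finite_imageI finite_comps_ge2)
  \<comment> \<open>Prepending 2 flips the sign, while \<open>inc_hd\<close> preserves it.\<close>
  then show ?thesis
    by (simp add: signed_count_def sum.reindex inj_on_subset[OF inj_inc_hd] sum_negf)
qed

text \<open>Applying the recurrence twice gives g(M + 3) = - g(M), so the initial values 1, 0, -1
  repeat in blocks of three with alternating sign. All three residues go through one induction
  because each value needs its two predecessors.\<close>

lemma signed_count_values: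
  "signed_count (3 * j) = (-1) ^ j \<and> signed_count (3 * j + 1) = 0 \<and>
   signed_count (3 * j + 2) = - ((-1) ^ j)"
proof (induction j)
  case 0
  show ?case
    by (simp add: numeral_2_eq_2 signed_count_Suc_Suc) (simp add: signed_count_def comps_ge2_0 comps_ge2_1)
next
  case (Suc j)
  have "signed_count (3 * j + 3) = - ((-1) ^ j)"
    using Suc.IH signed_count_Suc_Suc[of "3 * j + 1"] by (simp add: eval_nat_numeral)
  moreover from this have "signed_count (3 * j + 4) = 0"
    using Suc.IH signed_count_Suc_Suc[of "3 * j + 2"] by (simp add: eval_nat_numeral)
  ultimately show ?case
    using signed_count_Suc_Suc[of "3 * j + 3"] by (simp add: eval_nat_numeral)
qed

lemma sum_minus_one_power_length:
  assumes "finite A"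
  shows "(\<Sum>xs\<in>A. (-1) ^ length xs) =
    int (card {xs \<in> A. even (length xs)}) - int (card {xs \<in> A. odd (length xs)})"
proof -
  have "(\<Sum>xs\<in>A. (-1) ^ length xs) = (\<Sum>xs\<in>A. if even (length xs) then 1 else (-1::int))"
    by (intro sum.cong) auto
  then show ?thesis
    using assms by (simp add: sum.If_cases Int_def)
qed

context
  fixes r s k :: nat
  assumes s_less: "s < r" and k_eq: "k = 2 * r - s"
begin

lemma admissible_part_iff: "k \<le> a \<and> [a = k + s] (mod r) \<longleftrightarrow> (\<exists>m\<ge>2. a = r * m)"
proof -
  have "[a = k + s] (mod r) \<longleftrightarrow> r dvd a"
    using s_less k_eq by (simp add: cong_def mod_eq_0_iff_dvd)
  \<comment> \<open>Since k = r + (r - s) with s < r, k lies strictly above r and is at most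
    2r.\<close>
  moreover have "k \<le> r * m \<longleftrightarrow> 2 \<le> m" for m
  proof
    assume "k \<le> r * m"
    then have "r * 1 < r * m" using s_less k_eq by linarith
    then have "1 < m" by (simp only: mult_less_cancel1)
    then show "2 \<le> m" by simp
  next
    assume "2 \<le> m"
    then have "2 * r \<le> r * m" by simp
    then show "k \<le> r * m" using k_eq by linarith
  qed
  ultimately show ?thesis unfolding dvd_def by blast
qed

lemma compositions_altdef:
  "compositions r s k n = {xs \<in> map ((*) r) ` {ys. \<forall>a\<in>set ys. 2 \<le> a}. sum_list xs = n + k - 1}"
proof -
  have *: "(\<forall>a\<in>set xs. k \<le> a \<and> [a = k + s] (mod r)) \<longleftrightarrow>
      xs \<in> map ((*) r) ` {ys. \<forall>a\<in>set ys. 2 \<le> a}" for xs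
  proof -
    have "(\<forall>a\<in>set xs. k \<le> a \<and> [a = k + s] (mod r)) \<longleftrightarrow> xs \<in> lists ((*) r ` {2..})"
      unfolding admissible_part_iff by (auto simp: in_lists_conv_set)
    also have "lists ((*) r ` {2..}) = map ((*) r) ` {ys. \<forall>a\<in>set ys. 2 \<le> a}"
      unfolding lists_image by (simp add: lists_eq_set subset_iff Ball_def)
    finally show ?thesis .
  qed
  \<comment> \<open>The bound k \<le> a thus already forces the parts to be positive, as
    \<open>composition\<close> demands.\<close>
  have "0 < k" using s_less k_eq by linarith
  then show ?thesis
    unfolding compositions_def composition_def *[symmetric] by auto
qed

lemma sum_list_map_times: "sum_list (map ((*) r) ys) = r * sum_list ys"
  using sum_list_const_mult[of r "\<lambda>x. x" ys] by simp

lemma b_eq_0_if_not_dvd: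
  assumes "\<not> r dvd n + k - 1"
  shows "b r s k n = 0"
proof -
  have "compositions r s k n = {}"
    using assms by (auto simp: compositions_altdef sum_list_map_times) (metis dvd_triv_left)
  then show ?thesis by (simp add: b_def c_odd_def c_even_def)
qed

text \<open>Multiplying all parts by r is a length-preserving bijection from
  \<open>comps_ge2 M\<close>. The minus sign arises because \<open>b\<close> counts odd minus even,
  whereas (-1)^length counts even minus odd.\<close>

lemma b_eq_signed_count:
  assumes "n + k - 1 = r * M"
  shows "b r s k n = - signed_count M"
proof -
  have comps: "compositions r s k n = map ((*) r) ` comps_ge2 M"
    using assms s_less by (auto simp: compositions_altdef comps_ge2_def sum_list_map_times)
  have "inj ((*) r)" using s_less by (intro injI) simp
  then have inj: "inj_on (map ((*) r)) (comps_ge2 M)"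
    by (meson inj_mapI inj_on_subset subset_UNIV)
  have "(\<Sum>xs\<in>compositions r s k n. (-1) ^ length xs) = signed_count M"
    by (simp add: comps sum.reindex[OF inj] signed_count_def)
  moreover have "finite (compositions r s k n)"
    by (simp add: comps finite_comps_ge2)
  ultimately show ?thesis
    by (simp add: b_def c_odd_def c_even_def sum_minus_one_power_length)
qed

end

theorem corollary3p5:
  fixes r s k n :: nat
  assumes "s < r" and "k = 2 * r - s" and "1 \<le> n"
  shows "(\<forall>j::nat. n \<in> {3 * r * j + s + 1, 3 * r * j + r + s + 1} \<longrightarrow> b r s k n = (-1) ^ j) \<and>
         ((\<nexists>j::nat. n \<in> {3 * r * j + s + 1, 3 * r * j + r + s + 1}) \<longrightarrow> b r s k n = 0)"
proof (intro conjI allI impI)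
  fix j assume "n \<in> {3 * r * j + s + 1, 3 * r * j + r + s + 1}"
  then consider "n = 3 * r * j + s + 1" | "n = 3 * r * j + r + s + 1" by blast
  then show "b r s k n = (-1) ^ j"
  proof cases
    case 1
    \<comment> \<open>The s in n cancels against k = 2r - s, leaving 3rj + 2r.\<close>
    then have "n + k - 1 = r * (3 * j + 2)"
      using assms by (simp add: distrib_left)
    then show ?thesis
      using signed_count_values[of j] by (simp only: b_eq_signed_count[OF assms(1,2)] minus_minus)
  next
    case 2
    \<comment> \<open>The extra r moves the total to the next block of three, whose sign (-1)^(j +
      1) absorbs the minus.\<close>
    then have "n + k - 1 = r * (3 * Suc j)"
      using assms by (simp add: distrib_left)
    then show ?thesis
      using signed_count_values[of "Suc j"]
      by (simp only: b_eq_signed_count[OF assms(1,2)] power_Suc mult_minus1 minus_minus)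
  qed
next
  assume no: "\<nexists>j. n \<in> {3 * r * j + s + 1, 3 * r * j + r + s + 1}"
  show "b r s k n = 0"
  proof (cases "r dvd n + k - 1")
    case False
    then show ?thesis using b_eq_0_if_not_dvd[OF assms(1,2)] by blast
  next
    case True
    then obtain M where M: "n + k - 1 = r * M" by blast
    \<comment> \<open>Free of subtraction, this turns M = 3j + 2 and M = 3j + 3 into exactly the two
      excluded forms of n.\<close>
    have n: "n + 2 * r = r * M + s + 1" using M assms by linarith
    have "M \<noteq> 3 * j + 2" for j
      using no n by (auto simp: algebra_simps)
    moreover have "M \<noteq> 3 * Suc j" for j
      using no n by (auto simp: algebra_simps)
    \<comment> \<open>The remaining multiple of 3 would give n + 2r = s + 1, impossible for n \<ge>
      1 and s < r.\<close>
    moreover have "M \<noteq> 0" using n assms by (intro notI) simp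
    moreover have "M = 3 * (M div 3) \<or> M = 3 * (M div 3) + 1 \<or> M = 3 * (M div 3) + 2"
      by linarith
    ultimately have "M = 3 * (M div 3) + 1"
      by (cases "M div 3") fastforce+
    then have "signed_count M = 0" using signed_count_values[of "M div 3"] by simp
    then show ?thesis by (simp add: b_eq_signed_count[OF assms(1,2) M])
  qed
qed

end
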